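(* Let $X$ and $Y$ be independent, positive, non-degenerate random variables, and let $$U=\frac{Y}{1+X},\qquad V=X(1+U)=X\left(1+\frac{Y}{1+X}\right).$$ Suppose that $U$ and $V$ are independent. Then there exist $a,b,c>0$ such that $$X\sim\mathcal{K}(a,b-a,c)\qquad\text{and}\qquad Y\sim\mathcal{G}(b,c).$$
   Context: For $a>0$, $b\in\mathbb{R}$, $c>0$, the Kummer distribution $\mathcal{K}(a,b,c)$ is the probability distribution on $(0,\infty)$ with density proportional to $\dfrac{x^{a-1}e^{-cx}}{(1+x)^{a+b}}\,I_{(0,\infty)}(x)$. For $b>0$, $c>0$, the gamma distribution $\mathcal{G}(b,c)$ is the probability distribution on $(0,\infty)$ with density proportional to $y^{b-1}e^{-cy}I_{(0,\infty)}(y)$. A random variable is non-degenerate if it is not almost surely constant. *)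

theory Defs
  imports "HOL-Probability.Probability"
begin

text \<open>
  The Kummer and gamma laws are given by densities on \<open>(0, \<infinity>)\<close> up to proportionality; the
  constant is fixed by dividing by the total Lebesgue integral of the weight.
\<close>

definition normalized :: "(real \<Rightarrow> real) \<Rightarrow> real \<Rightarrow> real" where
  "normalized f x = f x / (\<integral>t. f t \<partial>lborel)"

definition kummer_density :: "real \<Rightarrow> real \<Rightarrow> real \<Rightarrow> real \<Rightarrow> real" where
  "kummer_density a b c =
     normalized (\<lambda>x. x powr (a - 1) * exp (- c * x) / (1 + x) powr (a + b) * indicator {0<..} x)"

definition gamma_density :: "real \<Rightarrow> real \<Rightarrow> real \<Rightarrow> real" where
  "gamma_density b c = normalized (\<lambda>y. y powr (b - 1) * exp (- c * y) * indicator {0<..} y)"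

definition nondegenerate :: "'a measure \<Rightarrow> ('a \<Rightarrow> real) \<Rightarrow> bool" where
  "nondegenerate M X \<longleftrightarrow> \<not> (\<exists>r. AE \<omega> in M. X \<omega> = r)"

end

theory Submission
  imports Defs
begin

text \<open>
  The map \<open>(x, y) \<mapsto> (u, v)\<close> is an involution with \<open>x + y = u + v\<close>, so that with
  \<open>A i j = E X^i (1+X)^-j e^(-sX)\<close>, \<open>B j = E Y^j e^(-sY)\<close>, \<open>C j i = E U^j (1+U)^-i e^(-sU)\<close> and
  \<open>D i = E V^i e^(-sV)\<close> independence gives \<open>A i j * B j = C j i * D i\<close>. The factor \<open>e^(-s(x+y))\<close>
  makes all moments finite. The splittings \<open>A i j = A i (j+1) + A (i+1) (j+1)\<close> and likewise for
  \<open>C\<close> then force the increments of \<open>B (j+1) / B j\<close> and of \<open>D (i+1) / D i\<close> to agree for all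
  \<open>i, j\<close>, hence to be a constant \<open>\<beta>(s)\<close>. Since \<open>B j' = - B (j+1)\<close>, this constant satisfies
  \<open>\<beta>' = - \<beta>\<^sup>2\<close>, so \<open>\<beta>(s) = 1 / (s + c)\<close>, and the Laplace transforms of \<open>Y\<close> and \<open>V\<close> are those of
  gamma laws with the same rate \<open>c\<close>. Finally, computing the expectation of a function of
  \<open>(X, U)\<close> once through \<open>(X, Y)\<close> and once through \<open>(U, V)\<close> yields the density of \<open>X\<close>.
\<close>

section \<open>Exponentially damped moments: bounds, splitting, derivative in
  \<open>s\<close>\<close>

text \<open>One functional serves all four families: \<open>A\<close> and \<open>C\<close> are its
  values for \<open>X\<close> and \<open>U\<close>, while \<open>B\<close> and \<open>D\<close> are
  its values for \<open>Y\<close> and \<open>V\<close> with denominator exponent 0.\<close>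

definition mixed_moment :: "'a measure \<Rightarrow> ('a \<Rightarrow> real) \<Rightarrow> nat \<Rightarrow> nat \<Rightarrow> real \<Rightarrow> real" where
  "mixed_moment M Z i j s = (\<integral>\<omega>. Z \<omega> ^ i / (1 + Z \<omega>) ^ j * exp (- s * Z \<omega>) \<partial>M)"

text \<open>A single term of the exponential series of \<open>s * z\<close> is at most the whole
  sum, since all terms are nonnegative.\<close>

lemma power_times_exp_neg_le:
  fixes s z :: real
  assumes "s > 0" "z \<ge> 0"
  shows "z ^ i * exp (- s * z) \<le> fact i / s ^ i"
proof -
  have "(s * z) ^ i / fact i \<le> exp (s * z)"
  proof -
    have "(s * z) ^ i / fact i = (\<Sum>k\<in>{i}. (s * z) ^ k / fact k)" by simp
    also have "\<dots> \<le> (\<Sum>k. (s * z) ^ k / fact k)"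
      using summable_exp[of "s * z"] assms
      by (intro sum_le_suminf) (auto simp: divide_inverse mult.commute)
    also have "\<dots> = exp (s * z)" by (simp add: exp_def divide_inverse mult.commute)
    finally show ?thesis .
  qed
  then show ?thesis using assms
    by (simp add: exp_minus field_simps power_mult_distrib)
qed

text \<open>Everything comes from \<open>1 + x \<le> exp x\<close>, used at \<open>u\<close> and at
  \<open>-u\<close>: it gives \<open>0 \<le> exp u - 1 - u \<le> u * (exp u - 1)\<close>, and the
  last factor is at most \<open>\<bar>u\<bar> * exp \<bar>u\<bar>\<close> in absolute value.\<close>

lemma exp_remainder_le:
  fixes u :: real
  shows "\<bar>exp u - 1 - u\<bar> \<le> u\<^sup>2 * exp \<bar>u\<bar>"
proof -
  have 0: "1 + u \<le> exp u" by (rule exp_ge_add_one_self)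
  have "(1 - u) * exp u \<le> exp (- u) * exp u"
    using exp_ge_add_one_self[of "- u"] by (intro mult_right_mono) auto
  then have 1: "exp u - 1 \<le> u * exp u" by (simp add: exp_minus algebra_simps)
  have 2: "\<bar>exp u - 1\<bar> \<le> \<bar>u\<bar> * exp \<bar>u\<bar>"
  proof (cases "u \<ge> 0")
    case False
    then have "exp u \<le> 1" and "\<bar>u\<bar> * 1 \<le> \<bar>u\<bar> * exp \<bar>u\<bar>" by (auto intro!: mult_left_mono)
    then show ?thesis using 0 False by linarith
  qed (use 1 in auto)
  have "\<bar>exp u - 1 - u\<bar> \<le> \<bar>u * (exp u - 1)\<bar>" using 0 1 by (simp add: algebra_simps)
  also have "\<dots> \<le> \<bar>u\<bar> * (\<bar>u\<bar> * exp \<bar>u\<bar>)" unfolding abs_mult by (intro mult_left_mono 2) auto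
  finally show ?thesis by (simp add: power2_eq_square algebra_simps)
qed

text \<open>Takes the place of differentiation under the integral sign: it suffices to integrate a
  pointwise second-order bound.\<close>

lemma DERIV_quadratic_remainder:
  fixes f :: "real \<Rightarrow> real"
  assumes "\<delta> > 0" and "\<And>h. \<bar>h\<bar> \<le> \<delta> \<Longrightarrow> \<bar>f (s + h) - f s - h * D\<bar> \<le> K * h\<^sup>2"
  shows "(f has_real_derivative D) (at s)"
proof -
  have "((\<lambda>h. (f (s + h) - f s) / h - D) \<longlongrightarrow> 0) (at 0)"
  proof (rule Lim_null_comparison)
    have "\<forall>\<^sub>F h in at 0. h \<noteq> 0 \<and> \<bar>h\<bar> \<le> \<delta>"
      unfolding eventually_at using assms(1) by (intro exI[of _ \<delta>]) (auto simp: dist_real_def)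
    then show "\<forall>\<^sub>F h in at 0. norm ((f (s + h) - f s) / h - D) \<le> K * \<bar>h\<bar>"
    proof eventually_elim
      case (elim h)
      then have "(f (s + h) - f s) / h - D = (f (s + h) - f s - h * D) / h" by (simp add: field_simps)
      then have "norm ((f (s + h) - f s) / h - D) = \<bar>f (s + h) - f s - h * D\<bar> / \<bar>h\<bar>" by simp
      also have "\<dots> \<le> K * h\<^sup>2 / \<bar>h\<bar>" using assms(2)[of h] elim by (intro divide_right_mono) auto
      also have "\<dots> = K * \<bar>h\<bar>" using elim by (simp add: power2_eq_square divide_simps abs_if)
      finally show ?case .
    qed
    have "((\<lambda>h::real. K * \<bar>h\<bar>) \<longlongrightarrow> K * \<bar>0\<bar>) (at 0)" by (intro tendsto_intros)
    then show "((\<lambda>h::real. K * \<bar>h\<bar>) \<longlongrightarrow> 0) (at 0)" by simp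
  qed
  then have "((\<lambda>h. (f (s + h) - f s) / h) \<longlongrightarrow> D) (at 0)" by (simp add: LIM_zero_iff)
  then show ?thesis by (simp add: DERIV_def)
qed

context prob_space
begin

lemma expectation_pos:
  fixes f :: "'a \<Rightarrow> real"
  assumes "integrable M f" "AE \<omega> in M. 0 < f \<omega>"
  shows "0 < expectation f"
proof -
  have "expectation f \<noteq> 0"
  proof
    assume "expectation f = 0"
    then have "AE \<omega> in M. f \<omega> = 0"
      using assms by (subst (asm) integral_nonneg_eq_0_iff_AE) (auto elim: eventually_mono)
    with assms(2) have "AE \<omega> in M. False" by eventually_elim auto
    then show False by simp
  qed
  moreover have "0 \<le> expectation f"
    using assms(2) by (intro integral_nonneg_AE) (auto elim: eventually_mono)
  ultimately show ?thesis by simp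
qed

lemma integrable_mixed_moment:
  fixes s :: real
  assumes [measurable]: "Z \<in> borel_measurable M" and pos: "AE \<omega> in M. 0 < Z \<omega>" and "0 < s"
  shows "integrable M (\<lambda>\<omega>. Z \<omega> ^ i / (1 + Z \<omega>) ^ j * exp (- s * Z \<omega>))"
proof (rule integrable_const_bound[of _ "fact i / s ^ i"])
  show "AE \<omega> in M. norm (Z \<omega> ^ i / (1 + Z \<omega>) ^ j * exp (- s * Z \<omega>)) \<le> fact i / s ^ i"
    using pos
  proof eventually_elim
    case (elim \<omega>)
    have "Z \<omega> ^ i / (1 + Z \<omega>) ^ j \<le> Z \<omega> ^ i"
      using elim divide_left_mono[of 1 "(1 + Z \<omega>) ^ j" "Z \<omega> ^ i"] by auto
    then have "Z \<omega> ^ i / (1 + Z \<omega>) ^ j * exp (- s * Z \<omega>) \<le> Z \<omega> ^ i * exp (- s * Z \<omega>)"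
      by (rule mult_right_mono) simp
    also have "\<dots> \<le> fact i / s ^ i" using elim \<open>0 < s\<close> by (intro power_times_exp_neg_le) auto
    finally show ?case using elim by (simp add: abs_mult)
  qed
qed measurable

lemma mixed_moment_pos:
  assumes "Z \<in> borel_measurable M" "AE \<omega> in M. 0 < Z \<omega>" "0 < s"
  shows "0 < mixed_moment M Z i j s"
  unfolding mixed_moment_def
  using assms(2) by (intro expectation_pos integrable_mixed_moment assms) (auto elim!: eventually_mono)

text \<open>Integrates the identity \<open>1 / (1 + z)^j = (1 + z) / (1 + z)^(j + 1)\<close>,
  multiplied by the remaining factors.\<close>

lemma mixed_moment_split:
  assumes "Z \<in> borel_measurable M" "AE \<omega> in M. 0 < Z \<omega>" "0 < s"
  shows "mixed_moment M Z i j s = mixed_moment M Z i (Suc j) s + mixed_moment M Z (Suc i) (Suc j) s"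
proof -
  have "mixed_moment M Z i (Suc j) s + mixed_moment M Z (Suc i) (Suc j) s =
      (\<integral>\<omega>. Z \<omega> ^ i / (1 + Z \<omega>) ^ Suc j * exp (- s * Z \<omega>) +
           Z \<omega> ^ Suc i / (1 + Z \<omega>) ^ Suc j * exp (- s * Z \<omega>) \<partial>M)"
    unfolding mixed_moment_def by (intro Bochner_Integration.integral_add[symmetric] integrable_mixed_moment assms)
  also have "\<dots> = mixed_moment M Z i j s"
    unfolding mixed_moment_def
  proof (rule integral_cong_AE)
    show "AE \<omega> in M. Z \<omega> ^ i / (1 + Z \<omega>) ^ Suc j * exp (- s * Z \<omega>) +
           Z \<omega> ^ Suc i / (1 + Z \<omega>) ^ Suc j * exp (- s * Z \<omega>) =
           Z \<omega> ^ i / (1 + Z \<omega>) ^ j * exp (- s * Z \<omega>)"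
      using assms(2)
    proof eventually_elim
      case (elim \<omega>)
      then have "1 + Z \<omega> \<noteq> 0" by simp
      then show ?case by (simp add: divide_simps) (simp add: algebra_simps)
    qed
  qed (use assms(1) in measurable)
  finally show ?thesis by simp
qed

text \<open>The Taylor remainder of \<open>exp (- h * z)\<close> costs a factor
  \<open>h^2 * z^2 * exp (\<bar>h\<bar> * z)\<close>. For \<open>\<bar>h\<bar> \<le> s / 2\<close>
  half of the damping \<open>exp (- s * z)\<close> absorbs the growth, so the moment of order
  \<open>n + 2\<close> at \<open>s / 2\<close> is a uniform constant \<open>K\<close>.\<close>

lemma DERIV_moment:
  assumes Z [measurable]: "Z \<in> borel_measurable M" and pos: "AE \<omega> in M. 0 < Z \<omega>" and "0 < s"
  shows "(mixed_moment M Z n 0 has_real_derivative - mixed_moment M Z (Suc n) 0 s) (at s)"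
proof (rule DERIV_quadratic_remainder)
  let ?m = "\<lambda>n. mixed_moment M Z n 0"
  fix h assume h: "\<bar>h\<bar> \<le> s / 2"
  have i: "integrable M (\<lambda>\<omega>. Z \<omega> ^ n * exp (- t * Z \<omega>))" if "0 < t" for n t
    using integrable_mixed_moment[OF Z pos that, of n 0] by simp
  have h': "0 < s + h" "0 < s / 2" using h \<open>0 < s\<close> by auto
  have eq: "?m n (s + h) - ?m n s - h * - ?m (Suc n) s =
    (\<integral>\<omega>. Z \<omega> ^ n * exp (- (s + h) * Z \<omega>) - Z \<omega> ^ n * exp (- s * Z \<omega>)
       - h * - (Z \<omega> ^ Suc n * exp (- s * Z \<omega>)) \<partial>M)"
    unfolding mixed_moment_def using i[OF h'(1)] i[OF \<open>0 < s\<close>, of n] i[OF \<open>0 < s\<close>, of "Suc n"]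
    by simp
  have "\<bar>?m n (s + h) - ?m n s - h * - ?m (Suc n) s\<bar> \<le> (\<integral>\<omega>. \<bar>Z \<omega> ^ n * exp (- (s + h) * Z \<omega>) - Z \<omega> ^ n * exp (- s * Z \<omega>)
       - h * - (Z \<omega> ^ Suc n * exp (- s * Z \<omega>))\<bar> \<partial>M)"
    unfolding eq by (rule integral_abs_bound)
  also have "\<dots> \<le> (\<integral>\<omega>. h\<^sup>2 * (Z \<omega> ^ Suc (Suc n) * exp (- (s / 2) * Z \<omega>)) \<partial>M)"
  proof (rule integral_mono_AE)
    show "integrable M (\<lambda>\<omega>. \<bar>Z \<omega> ^ n * exp (- (s + h) * Z \<omega>) - Z \<omega> ^ n * exp (- s * Z \<omega>)
       - h * - (Z \<omega> ^ Suc n * exp (- s * Z \<omega>))\<bar>)"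
      using i[OF h'(1), of n] i[OF \<open>0 < s\<close>, of n] i[OF \<open>0 < s\<close>, of "Suc n"]
      by (intro integrable_abs Bochner_Integration.integrable_diff integrable_mult_right[of h]
          Bochner_Integration.integrable_minus)
    show "integrable M (\<lambda>\<omega>. h\<^sup>2 * (Z \<omega> ^ Suc (Suc n) * exp (- (s / 2) * Z \<omega>)))"
      by (rule integrable_mult_right[OF i[OF h'(2)]])
    show "AE \<omega> in M. \<bar>Z \<omega> ^ n * exp (- (s + h) * Z \<omega>) - Z \<omega> ^ n * exp (- s * Z \<omega>)
       - h * - (Z \<omega> ^ Suc n * exp (- s * Z \<omega>))\<bar>
       \<le> h\<^sup>2 * (Z \<omega> ^ Suc (Suc n) * exp (- (s / 2) * Z \<omega>))"
      using pos
    proof eventually_elim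
      case (elim \<omega>)
      let ?z = "Z \<omega>"
      let ?c = "?z ^ n * exp (- s * ?z)"
      have "\<bar>?z ^ n * exp (- (s + h) * ?z) - ?z ^ n * exp (- s * ?z) - h * - (?z ^ Suc n * exp (- s * ?z))\<bar>
        = \<bar>?c * (exp (- h * ?z) - 1 - (- h * ?z))\<bar>"
      proof -
        have "exp (- (s + h) * ?z) = exp (- s * ?z) * exp (- h * ?z)"
          by (simp add: algebra_simps flip: exp_add)
        then show ?thesis by (simp only: right_diff_distrib) (simp add: mult_ac)
      qed
      also have "\<dots> = ?c * \<bar>exp (- h * ?z) - 1 - (- h * ?z)\<bar>" using elim by (simp add: abs_mult)
      also have "\<dots> \<le> ?c * ((- h * ?z)\<^sup>2 * exp \<bar>- h * ?z\<bar>)"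
        using elim by (intro mult_left_mono exp_remainder_le) auto
      also have "\<dots> = h\<^sup>2 * (?z ^ Suc (Suc n) * exp (- s * ?z + \<bar>h\<bar> * ?z))"
        using elim by (simp only: exp_add) (simp add: abs_mult power2_eq_square)
      also have "\<dots> \<le> h\<^sup>2 * (?z ^ Suc (Suc n) * exp (- (s / 2) * ?z))"
      proof -
        have "\<bar>h\<bar> * ?z \<le> s / 2 * ?z" using elim h by (intro mult_right_mono) auto
        then show ?thesis using elim by (intro mult_left_mono) (auto simp: algebra_simps)
      qed
      finally show ?case .
    qed
  qed
  also have "\<dots> = ?m (Suc (Suc n)) (s / 2) * h\<^sup>2" unfolding mixed_moment_def by simp
  finally show "\<bar>?m n (s + h) - ?m n s - h * - ?m (Suc n) s\<bar> \<le> ?m (Suc (Suc n)) (s / 2) * h\<^sup>2" .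
qed (use \<open>0 < s\<close> in simp)

end

section \<open>The recursion forced by the two moment arrays\<close>

text \<open>Splitting \<open>C\<close> and translating back through \<open>AC\<close> gives a linear
  relation \<open>rel\<close> on the array \<open>A\<close> with coefficients \<open>b j\<close> and
  \<open>d i\<close>. Compatibility of \<open>rel\<close> with the splitting of \<open>A\<close>
  ties \<open>b (j + 1) - b j\<close> to \<open>d (i + 1) - d i\<close>.\<close>

lemma equal_increments:
  fixes A C :: "nat \<Rightarrow> nat \<Rightarrow> real" and B D :: "nat \<Rightarrow> real"
  assumes pos: "\<And>i j. 0 < A i j" "\<And>j. 0 < B j" "\<And>i. 0 < D i"
    and AC: "\<And>i j. A i j * B j = C j i * D i"
    and splitA: "\<And>i j. A i j = A i (Suc j) + A (Suc i) (Suc j)"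
    and splitC: "\<And>j i. C j i = C j (Suc i) + C (Suc j) (Suc i)"
  shows "B (Suc (Suc j)) / B (Suc j) - B (Suc j) / B j = D (Suc (Suc i)) / D (Suc i) - D (Suc i) / D i"
proof -
  define b d where "b j = B (Suc j) / B j" and "d i = D (Suc i) / D i" for j i
  have B: "B (Suc j) = b j * B j" and D: "D (Suc i) = d i * D i" for i j
    using pos(2)[of j] pos(3)[of i] by (auto simp: b_def d_def)
  \<comment> \<open>After multiplication by \<open>B j\<close> the left side is
    \<open>C j i * D (i + 1)\<close>; the two pieces of \<open>C j i\<close> become entries of row
    \<open>i + 1\<close> of \<open>A\<close>, with weights \<open>B j\<close> and
    \<open>B (j + 1)\<close>.\<close>
  have rel: "d i * A i j = A (Suc i) j + b j * A (Suc i) (Suc j)" for i j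
  proof -
    have "d i * (A i j * B j) = (C j (Suc i) + C (Suc j) (Suc i)) * (d i * D i)"
      using AC[of i j] splitC[of j i] by (simp add: algebra_simps)
    also have "\<dots> = A (Suc i) j * B j + A (Suc i) (Suc j) * (b j * B j)"
      using AC[of "Suc i" j] AC[of "Suc i" "Suc j"] unfolding B D by (simp add: algebra_simps)
    also have "\<dots> = (A (Suc i) j + b j * A (Suc i) (Suc j)) * B j" by (simp add: algebra_simps)
    finally have "(d i * A i j) * B j = (A (Suc i) j + b j * A (Suc i) (Suc j)) * B j"
      by (simp only: mult.assoc)
    then show ?thesis using pos(2)[of j] by simp
  qed
  \<comment> \<open>Split the entry, apply \<open>rel\<close> at \<open>(i, j + 1)\<close> and
    \<open>(i + 1, j + 1)\<close>, merge the resulting entries by the splitting again, and finish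
    with \<open>rel\<close> at \<open>(i, j)\<close>.\<close>
  have "b (Suc j) * A (Suc i) (Suc j) = (b j + (d (Suc i) - d i)) * A (Suc i) (Suc j)"
  proof -
    have "b (Suc j) * A (Suc i) (Suc j) = b (Suc j) * A (Suc i) (Suc (Suc j)) + b (Suc j) * A (Suc (Suc i)) (Suc (Suc j))"
      by (subst splitA) (simp add: distrib_left)
    also have "\<dots> = d i * A i (Suc j) - A (Suc i) (Suc j) + (d (Suc i) * A (Suc i) (Suc j) - A (Suc (Suc i)) (Suc j))"
      using rel[of i "Suc j"] rel[of "Suc i" "Suc j"] by simp
    also have "\<dots> = d i * (A i j - A (Suc i) (Suc j)) + d (Suc i) * A (Suc i) (Suc j) - A (Suc i) j"
      using splitA[of i j] splitA[of "Suc i" j] by simp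
    also have "\<dots> = (b j + (d (Suc i) - d i)) * A (Suc i) (Suc j)"
      using rel[of i j] by (simp add: algebra_simps)
    finally show ?thesis .
  qed
  then have "b (Suc j) = b j + (d (Suc i) - d i)"
    using pos(1)[of "Suc i" "Suc j"] by (simp only: mult_cancel_right) auto
  then show ?thesis by (simp add: b_def d_def)
qed

section \<open>Solving the differential equations for the moment ratios\<close>

lemma constant_on_pos_reals:
  fixes f :: "real \<Rightarrow> real"
  assumes "\<And>s. 0 < s \<Longrightarrow> (f has_real_derivative 0) (at s)" and "0 < s" "0 < t"
  shows "f s = f t"
proof -
  have "\<exists>c. \<forall>x\<in>{0<..}. f x = c"
    by (rule has_field_derivative_zero_constant)
       (use assms(1) in \<open>auto intro: has_field_derivative_at_within\<close>)
  with assms show ?thesis by auto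
qed

context prob_space
begin

text \<open>Up to the factor \<open>B 1\<close> the increment is the integral of
  \<open>(Z - m)^2 * exp (- s * Z)\<close>, where \<open>m\<close> is the mean of \<open>Z\<close>
  under the exponentially tilted law. It vanishes only if \<open>Z\<close> is almost surely
  \<open>m\<close>.\<close>

lemma moment_ratio_increment_pos:
  assumes Z [measurable]: "Z \<in> borel_measurable M" and pos: "AE \<omega> in M. 0 < Z \<omega>" and "0 < s"
    and nd: "nondegenerate M Z"
  shows "0 < mixed_moment M Z 2 0 s / mixed_moment M Z 1 0 s - mixed_moment M Z 1 0 s / mixed_moment M Z 0 0 s"
proof -
  define B where "B n = mixed_moment M Z n 0 s" for n
  have Bpos: "0 < B n" for n unfolding B_def using assms by (intro mixed_moment_pos)
  have i: "integrable M (\<lambda>\<omega>. Z \<omega> ^ n * exp (- s * Z \<omega>))" for n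
    using integrable_mixed_moment[OF Z pos \<open>0 < s\<close>, of n 0] by simp
  define m where "m = B 1 / B 0"
  have split: "(Z \<omega> - m)\<^sup>2 * exp (- s * Z \<omega>) = Z \<omega> ^ 2 * exp (- s * Z \<omega>)
      - 2 * m * (Z \<omega> ^ 1 * exp (- s * Z \<omega>)) + m\<^sup>2 * (Z \<omega> ^ 0 * exp (- s * Z \<omega>))" for \<omega>
    by (simp add: power2_eq_square algebra_simps)
  have int: "integrable M (\<lambda>\<omega>. (Z \<omega> - m)\<^sup>2 * exp (- s * Z \<omega>))"
    unfolding split
    by (rule Bochner_Integration.integrable_add[OF Bochner_Integration.integrable_diff
         [OF i integrable_mult_right[OF i]] integrable_mult_right[OF i]])
  have "(\<integral>\<omega>. (Z \<omega> - m)\<^sup>2 * exp (- s * Z \<omega>) \<partial>M) = B 2 - 2 * m * B 1 + m\<^sup>2 * B 0"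
    unfolding split B_def mixed_moment_def using i[of 2] i[of 1] i[of 0] by simp
  moreover have "(\<integral>\<omega>. (Z \<omega> - m)\<^sup>2 * exp (- s * Z \<omega>) \<partial>M) \<noteq> 0"
  proof
    assume "(\<integral>\<omega>. (Z \<omega> - m)\<^sup>2 * exp (- s * Z \<omega>) \<partial>M) = 0"
    then have "AE \<omega> in M. (Z \<omega> - m)\<^sup>2 * exp (- s * Z \<omega>) = 0"
      using integral_nonneg_eq_0_iff_AE[OF int] by simp
    then have "AE \<omega> in M. Z \<omega> = m" by eventually_elim simp
    with nd show False by (auto simp: nondegenerate_def)
  qed
  moreover have "0 \<le> (\<integral>\<omega>. (Z \<omega> - m)\<^sup>2 * exp (- s * Z \<omega>) \<partial>M)" by (rule Bochner_Integration.integral_nonneg) simp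
  ultimately have "0 < B 2 - 2 * m * B 1 + m\<^sup>2 * B 0" by simp
  also have "\<dots> = B 1 * (B 2 / B 1 - B 1 / B 0)"
    using Bpos[of 0] Bpos[of 1] by (simp add: m_def field_simps power2_eq_square)
  finally show ?thesis using Bpos[of 1] by (simp add: zero_less_mult_iff B_def)
qed

text \<open>Supplies the boundary value at 0 that fixes the constant of integration of the Laplace
  transform.\<close>

lemma laplace_tendsto_1:
  assumes [measurable]: "Z \<in> borel_measurable M" and pos: "AE \<omega> in M. 0 < Z \<omega>"
  shows "(\<lambda>n. mixed_moment M Z 0 0 (1 / real (Suc n))) \<longlonglongrightarrow> 1"
proof -
  have "(\<lambda>n. \<integral>\<omega>. exp (- (1 / real (Suc n)) * Z \<omega>) \<partial>M) \<longlonglongrightarrow> (\<integral>\<omega>. 1 \<partial>M)"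
  proof (rule integral_dominated_convergence[of _ _ _ "\<lambda>_. 1"])
    have "(\<lambda>n. exp (- (1 / real (Suc n)) * Z \<omega>)) \<longlonglongrightarrow> exp (- 0 * Z \<omega>)" for \<omega>
      using LIMSEQ_inverse_real_of_nat by (intro tendsto_intros) (simp add: inverse_eq_divide)
    then show "AE \<omega> in M. (\<lambda>n. exp (- (1 / real (Suc n)) * Z \<omega>)) \<longlonglongrightarrow> 1" by simp
    show "AE \<omega> in M. norm (exp (- (1 / real (Suc n)) * Z \<omega>)) \<le> 1" for n
      using pos by eventually_elim simp
  qed auto
  then show ?thesis by (simp add: mixed_moment_def prob_space)
qed

text \<open>From \<open>B n' = - B (n + 1)\<close> follows
  \<open>r n' = r n * (r n - r (n + 1))\<close>. Equality of the first two increments closes this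
  system: \<beta> solves a Riccati equation, \<open>r 0\<close> is proportional to \<beta>, and
  \<open>r 0\<close> is minus the logarithmic derivative of \<open>B 0\<close>.\<close>

lemma laplace_transform_of_arithmetic_ratios:
  fixes Z :: "'a \<Rightarrow> real"
  defines "r \<equiv> \<lambda>n s. mixed_moment M Z (Suc n) 0 s / mixed_moment M Z n 0 s"
  assumes Z: "Z \<in> borel_measurable M" and pos: "AE \<omega> in M. 0 < Z \<omega>"
    and incr_pos: "\<And>s. 0 < s \<Longrightarrow> r 0 s < r 1 s"
    and incr_eq: "\<And>s. 0 < s \<Longrightarrow> r 2 s - r 1 s = r 1 s - r 0 s"
  obtains c k where "0 < c" "0 < k"
    and "\<And>s. 0 < s \<Longrightarrow> r 1 s - r 0 s = 1 / (s + c)"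
    and "\<And>s. 0 < s \<Longrightarrow> mixed_moment M Z 0 0 s = (c / (s + c)) powr k"
proof -
  define B where "B n = mixed_moment M Z n 0" for n
  have Bpos: "0 < B n s" if "0 < s" for n s unfolding B_def using that Z pos by (intro mixed_moment_pos)
  have dB: "(B n has_real_derivative - B (Suc n) s) (at s)" if "0 < s" for n s
    unfolding B_def using that Z pos by (intro DERIV_moment)
  have r: "r n s = B (Suc n) s / B n s" for n s by (simp add: r_def B_def)
  have rpos: "0 < r n s" if "0 < s" for n s using Bpos[OF that] by (simp add: r)
  have dr: "(r n has_real_derivative r n s * (r n s - r (Suc n) s)) (at s)" if "0 < s" for n s
  proof -
    have "B n s \<noteq> 0" "B (Suc n) s \<noteq> 0" using Bpos[OF that, of n] Bpos[OF that, of "Suc n"] by auto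
    then have "((\<lambda>s. B (Suc n) s / B n s) has_real_derivative r n s * (r n s - r (Suc n) s)) (at s)"
      by (auto intro!: derivative_eq_intros dB that simp: r field_simps power2_eq_square)
    then show ?thesis by (simp add: r[abs_def])
  qed
  define \<beta> where "\<beta> s = r 1 s - r 0 s" for s
  have \<beta>pos: "0 < \<beta> s" if "0 < s" for s using incr_pos[OF that] by (simp add: \<beta>_def)
  have d\<beta>: "(\<beta> has_real_derivative - (\<beta> s)\<^sup>2) (at s)" if "0 < s" for s
  proof -
    have "((\<lambda>s. r 1 s - r 0 s) has_real_derivative r 1 s * (r 1 s - r 2 s) - r 0 s * (r 0 s - r 1 s)) (at s)"
      using dr[OF that, of 1] dr[OF that, of 0] by (auto intro!: derivative_eq_intros simp: numeral_2_eq_2)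
    moreover have "r 1 s * (r 1 s - r 2 s) - r 0 s * (r 0 s - r 1 s) = - (\<beta> s)\<^sup>2"
    proof -
      have "r 2 s = 2 * r 1 s - r 0 s" using incr_eq[OF that] by simp
      then show ?thesis unfolding \<beta>_def by (simp only:) (simp add: power2_eq_square algebra_simps)
    qed
    ultimately show ?thesis by (simp add: \<beta>_def[abs_def])
  qed
  define c where "c = 1 / \<beta> 1 - 1"
  \<comment> \<open>The equation for \<beta> says that \<open>1 / \<beta> s\<close> has derivative
    1; \<open>c\<close> is the constant difference, read off at \<open>s = 1\<close>.\<close>
  have \<beta>c: "1 / \<beta> s = s + c" if "0 < s" for s
  proof -
    have "1 / \<beta> s - s = 1 / \<beta> 1 - 1"
    proof (rule constant_on_pos_reals[OF _ that])
      fix s :: real assume "0 < s"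
      then show "((\<lambda>s. 1 / \<beta> s - s) has_real_derivative 0) (at s)"
        using \<beta>pos[of s] by (auto intro!: derivative_eq_intros d\<beta> simp: power2_eq_square)
    qed simp
    then show ?thesis by (simp add: c_def)
  qed
  have sc: "0 < s + c" if "0 < s" for s
    using \<beta>pos[OF that] \<beta>c[OF that] by (metis zero_less_divide_1_iff)
  have \<beta>: "\<beta> s = 1 / (s + c)" if "0 < s" for s
    using \<beta>c[OF that] by (metis div_by_1 divide_divide_eq_right mult_1)
  define k where "k = r 0 1 / \<beta> 1"
  have "0 < k" using rpos[of 1] \<beta>pos[of 1] by (simp add: k_def)
  have r0: "r 0 s = k / (s + c)" if "0 < s" for s
  proof -
    \<comment> \<open>Both \<open>r 0\<close> and \<beta> have logarithmic derivative
      \<open>- \<beta>\<close>, so their quotient is constant.\<close>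
    have "r 0 s / \<beta> s = r 0 1 / \<beta> 1"
    proof (rule constant_on_pos_reals[OF _ that])
      fix s :: real assume s: "0 < s"
      have "((\<lambda>s. r 0 s / \<beta> s) has_real_derivative
          (r 0 s * (r 0 s - r (Suc 0) s) * \<beta> s - r 0 s * - (\<beta> s)\<^sup>2) / (\<beta> s * \<beta> s)) (at s)"
        using \<beta>pos[OF s] by (intro DERIV_divide dr d\<beta> s) auto
      moreover have "r 0 s - r (Suc 0) s = - \<beta> s" by (simp add: \<beta>_def)
      ultimately show "((\<lambda>s. r 0 s / \<beta> s) has_real_derivative 0) (at s)"
        by (simp add: power2_eq_square)
    qed simp
    then have "r 0 s / \<beta> s = k" by (simp only: k_def)
    then show ?thesis using \<beta>[OF that] \<beta>pos[OF that] by (auto simp: divide_eq_eq)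
  qed
  define K where "K = B 0 1 * (1 + c) powr k"
  have B0: "B 0 s * (s + c) powr k = K" if "0 < s" for s
  proof -
    have "B 0 s * (s + c) powr k = B 0 1 * (1 + c) powr k"
    proof (rule constant_on_pos_reals[OF _ that])
      fix s :: real assume s: "0 < s"
      have "((\<lambda>s. B 0 s * (s + c) powr k) has_real_derivative
          - B (Suc 0) s * (s + c) powr k + B 0 s * (k * (s + c) powr (k - 1))) (at s)"
        using sc[OF s] by (auto intro!: derivative_eq_intros dB s)
      moreover have "B (Suc 0) s = B 0 s * (k / (s + c))"
        using r0[OF s] Bpos[OF s, of 0] by (simp add: r field_simps)
      moreover have "(s + c) powr (k - 1) = (s + c) powr k / (s + c)"
        using sc[OF s] by (simp add: powr_diff)
      ultimately show "((\<lambda>s. B 0 s * (s + c) powr k) has_real_derivative 0) (at s)"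
        by simp
    qed simp
    then show ?thesis by (simp add: K_def)
  qed
  have "0 < K" using B0[of 1] Bpos[of 1 0] sc[of 1] by (metis mult_pos_pos powr_gt_zero zero_less_one less_irrefl)
  \<comment> \<open>For negative \<open>c\<close> the point \<open>s = - c\<close> is positive, and
    \<open>sc\<close> would read \<open>0 < 0\<close>.\<close>
  have "c \<ge> 0" using sc[of "- c"] by force
  \<comment> \<open>The case \<open>c = 0\<close> is still open here; since \<open>k > 0\<close>,
    the limit of the power is valid at base 0 too.\<close>
  have lim: "(\<lambda>n. B 0 (1 / real (Suc n)) * (1 / real (Suc n) + c) powr k) \<longlonglongrightarrow> 1 * (0 + c) powr k"
    using LIMSEQ_inverse_real_of_nat \<open>0 \<le> c\<close> \<open>0 < k\<close> unfolding B_def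
    by (intro tendsto_intros laplace_tendsto_1 Z pos)
       (auto simp: inverse_eq_divide intro!: always_eventually)
  have "(\<lambda>n. B 0 (1 / real (Suc n)) * (1 / real (Suc n) + c) powr k) = (\<lambda>n. K)"
    by (rule ext, rule B0) simp
  then have Kc: "K = c powr k" using lim by (simp add: LIMSEQ_const_iff)
  \<comment> \<open>At \<open>c = 0\<close> the value \<open>0 powr k = 0\<close> would contradict
    \<open>K > 0\<close>.\<close>
  with \<open>0 < K\<close> \<open>0 \<le> c\<close> have "0 < c" by (cases "c = 0") auto
  show thesis
  proof (rule that[OF \<open>0 < c\<close> \<open>0 < k\<close>])
    fix s :: real assume s: "0 < s"
    show "r 1 s - r 0 s = 1 / (s + c)" using \<beta>[OF s] by (simp add: \<beta>_def)
    show "mixed_moment M Z 0 0 s = (c / (s + c)) powr k"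
      using B0[OF s] Kc sc[OF s] \<open>0 < c\<close> by (simp add: B_def powr_divide field_simps)
  qed
qed

end

section \<open>Uniqueness of laws from moments and from Laplace transforms\<close>

text \<open>By Weierstrass approximation on the unit interval, equal moments give equal integrals of
  all continuous step functions. These determine the law through weak convergence and characteristic
  functions.\<close>

theorem hausdorff_moment_uniqueness:
  fixes P Q :: "real measure"
  assumes P: "real_distribution P" and Q: "real_distribution Q"
    and P01: "AE x in P. x \<in> {0..1}" and Q01: "AE x in Q. x \<in> {0..1}"
    and eq: "\<And>n. (\<integral>x. x ^ n \<partial>P) = (\<integral>x. x ^ n \<partial>Q)"
  shows "P = Q"
proof -
  have step_eq: "(\<integral>x. cts_step u v x \<partial>P) = (\<integral>x. cts_step u v x \<partial>Q)" if "u < v" for u v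
  proof (rule ccontr)
    let ?f = "cts_step u v"
    \<comment> \<open>One third of the gap: an approximation error of at most \<open>e\<close> under
      each law leaves a gap of at most \<open>2 * e\<close>, whereas it equals
      \<open>3 * e\<close>.\<close>
    define e where "e = \<bar>(\<integral>x. ?f x \<partial>P) - (\<integral>x. ?f x \<partial>Q)\<bar> / 3"
    assume "(\<integral>x. ?f x \<partial>P) \<noteq> (\<integral>x. ?f x \<partial>Q)"
    then have "0 < e" by (simp add: e_def)
    moreover have "continuous_on {0..1} ?f"
      using uniformly_continuous_imp_continuous[OF cts_step_uniformly_continuous[OF that]]
      by (rule continuous_on_subset) simp
    ultimately obtain g where "real_polynomial_function g" and g: "\<And>x. x \<in> {0..1} \<Longrightarrow> \<bar>?f x - g x\<bar> < e"
      using Stone_Weierstrass_real_polynomial_function[of "{0..1}" ?f e] by auto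
    then obtain a n where a: "g = (\<lambda>x. \<Sum>i\<le>n. a i * x ^ i)"
      by (auto simp: real_polynomial_function_iff_sum)
    have *: "integrable R (\<lambda>x. x ^ i) \<and> \<bar>(\<integral>x. ?f x \<partial>R) - (\<integral>x. g x \<partial>R)\<bar> \<le> e"
      if R: "real_distribution R" and R01: "AE x in R. x \<in> {0..1}" for R i
    proof -
      interpret R: real_distribution R by (rule R)
      have pow: "integrable R (\<lambda>x. x ^ i)" for i
      proof (rule R.integrable_const_bound[of _ 1])
        show "AE x in R. norm (x ^ i) \<le> 1"
          using R01 by eventually_elim (auto simp: power_abs intro!: power_le_one)
      qed simp
      have g_int: "integrable R g" unfolding a using pow by simp
      have f_int: "integrable R ?f" using \<open>u < v\<close> by (rule R.integrable_cts_step)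
      have "\<bar>(\<integral>x. ?f x \<partial>R) - (\<integral>x. g x \<partial>R)\<bar> = \<bar>\<integral>x. ?f x - g x \<partial>R\<bar>"
        using f_int g_int by simp
      also have "\<dots> \<le> (\<integral>x. \<bar>?f x - g x\<bar> \<partial>R)" by (rule integral_abs_bound)
      also have "\<dots> \<le> (\<integral>x. e \<partial>R)"
      proof (rule integral_mono_AE)
        show "AE x in R. \<bar>?f x - g x\<bar> \<le> e" using R01 by eventually_elim (use g in force)
      qed (use f_int g_int in auto)
      finally show ?thesis using pow R.prob_space by simp
    qed
    have "(\<integral>x. g x \<partial>P) = (\<integral>x. g x \<partial>Q)"
      unfolding a using *[OF P P01] *[OF Q Q01] eq by simp
    then have "\<bar>(\<integral>x. ?f x \<partial>P) - (\<integral>x. ?f x \<partial>Q)\<bar> \<le> 2 * e"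
      using *[OF P P01, THEN conjunct2] *[OF Q Q01, THEN conjunct2] by linarith
    with \<open>0 < e\<close> show False by (simp add: e_def)
  qed
  \<comment> \<open>The constant sequence \<open>P\<close> converges weakly to \<open>Q\<close>, so
    the constant sequence \<open>char P t\<close> has limit \<open>char Q t\<close>.\<close>
  have "weak_conv_m (\<lambda>n. P) Q"
    using P Q step_eq by (intro integral_cts_step_conv_imp_weak_conv) simp_all
  then have "(\<lambda>n. char P t) \<longlonglongrightarrow> char Q t" for t
    using P Q by (intro levy_continuity1)
  then have "char P = char Q" by (intro ext) (simp add: LIMSEQ_const_iff)
  then show ?thesis by (rule Levy_uniqueness[OF P Q])
qed

text \<open>The map \<open>exp (- x)\<close> carries the half-line into the unit interval and turns
  Laplace transforms at natural numbers into moments; pushing forward by \<open>- ln t\<close>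
  undoes it.\<close>

corollary laplace_uniqueness:
  fixes P Q :: "real measure"
  assumes P: "real_distribution P" and Q: "real_distribution Q"
    and Ppos: "AE x in P. 0 \<le> x" and Qpos: "AE x in Q. 0 \<le> x"
    and eq: "\<And>n. (\<integral>x. exp (- real n * x) \<partial>P) = (\<integral>x. exp (- real n * x) \<partial>Q)"
  shows "P = Q"
proof -
  interpret P: real_distribution P by (rule P)
  interpret Q: real_distribution Q by (rule Q)
  let ?e = "\<lambda>x::real. exp (- x)" and ?l = "\<lambda>t::real. - ln t"
  have pow: "?e x ^ n = exp (- real n * x)" for x n
    by (simp add: exp_of_nat_mult[symmetric])
  have "distr P borel ?e = distr Q borel ?e"
  proof (rule hausdorff_moment_uniqueness)
    show "real_distribution (distr P borel ?e)" "real_distribution (distr Q borel ?e)"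
      by (auto intro!: P.real_distribution_distr Q.real_distribution_distr)
    show "AE x in distr P borel ?e. x \<in> {0..1}" using Ppos by (subst AE_distr_iff) auto
    show "AE x in distr Q borel ?e. x \<in> {0..1}" using Qpos by (subst AE_distr_iff) auto
    show "(\<integral>x. x ^ n \<partial>distr P borel ?e) = (\<integral>x. x ^ n \<partial>distr Q borel ?e)" for n
      using eq[of n] by (simp add: integral_distr pow)
  qed
  then have "distr (distr P borel ?e) borel ?l = distr (distr Q borel ?e) borel ?l" by simp
  then show ?thesis by (simp add: distr_distr comp_def distr_id2)
qed

section \<open>Normalisation, Laplace transform and identification of the gamma law\<close>

lemma has_bochner_integral_gamma_weight:
  fixes b t :: real
  assumes "0 < b" "0 < t"
  shows "has_bochner_integral lborel (\<lambda>y. y powr (b - 1) * exp (- t * y) * indicator {0<..} y) (Gamma b / t powr b)"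
proof (rule has_bochner_integral_nn_integral)
  let ?I = "\<integral>\<^sup>+y. ennreal (y powr (b - 1) * exp (- t * y) * indicator {0<..} y) \<partial>lborel"
  have "ennreal (Gamma b) = (\<integral>\<^sup>+y. ennreal (indicator {0..} y * y powr (b - 1) / exp y) \<partial>lborel)"
    using assms(1) by (rule Gamma_conv_nn_integral_real)
  also have "\<dots> = ennreal t * (\<integral>\<^sup>+y. ennreal (indicator {0..} (0 + t * y) * (0 + t * y) powr (b - 1) / exp (0 + t * y)) \<partial>lborel)"
    using assms(2) by (subst nn_integral_real_affine[where c = t and t = 0]) auto
  \<comment> \<open>Replacing the closed half-line by the open one changes nothing even at the point
    0, because \<open>0 powr (b - 1)\<close> is 0.\<close>
  also have "\<dots> = ennreal t * (\<integral>\<^sup>+y. ennreal (t powr (b - 1)) * ennreal (y powr (b - 1) * exp (- t * y) * indicator {0<..} y) \<partial>lborel)"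
    using assms(2)
    by (intro arg_cong2[where f = "(*)"] nn_integral_cong refl)
       (auto simp: indicator_def exp_minus powr_mult field_simps zero_le_mult_iff not_less simp flip: ennreal_mult')
  also have "\<dots> = ennreal (t powr b) * ?I"
  proof -
    have "t * t powr (b - 1) = t powr b" using assms(2) by (simp add: powr_mult_base)
    then have "ennreal t * ennreal (t powr (b - 1)) = ennreal (t powr b)"
      using assms(2) by (subst ennreal_mult'[symmetric]) simp_all
    then show ?thesis by (subst nn_integral_cmult) (simp_all only: mult.assoc[symmetric], measurable)
  qed
  finally have "ennreal (1 / t powr b) * ennreal (Gamma b) = ennreal (1 / t powr b) * (ennreal (t powr b) * ?I)"
    by simp
  then show "?I = ennreal (Gamma b / t powr b)"
    using assms(2) by (simp add: mult.assoc[symmetric] ennreal_mult'[symmetric])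
  show "0 \<le> Gamma b / t powr b" using assms by (auto intro: less_imp_le Gamma_real_pos)
qed (auto simp: indicator_def)

lemma gamma_density_eq:
  assumes "0 < b" "0 < c"
  shows "gamma_density b c y = c powr b / Gamma b * (y powr (b - 1) * exp (- c * y) * indicator {0<..} y)"
  unfolding gamma_density_def normalized_def
  using has_bochner_integral_integral_eq[OF has_bochner_integral_gamma_weight[OF assms]] by simp

lemma gamma_density_nonneg: "0 < b \<Longrightarrow> 0 < c \<Longrightarrow> 0 \<le> gamma_density b c y"
  by (simp add: gamma_density_eq Gamma_real_pos less_imp_le)

lemma borel_measurable_gamma_density [measurable]: "gamma_density b c \<in> borel_measurable borel"
  unfolding gamma_density_def normalized_def[abs_def] by measurable

text \<open>The factor \<open>exp (- s * y)\<close> only raises the rate from \<open>c\<close> to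
  \<open>s + c\<close>. The value \<open>s = 0\<close> is included to yield total mass 1.\<close>

lemma has_bochner_integral_gamma_density_laplace:
  assumes "0 < b" "0 < c" "0 \<le> s"
  shows "has_bochner_integral lborel (\<lambda>y. gamma_density b c y * exp (- s * y)) ((c / (s + c)) powr b)"
proof -
  have "has_bochner_integral lborel
      (\<lambda>y. c powr b / Gamma b * (y powr (b - 1) * exp (- (s + c) * y) * indicator {0<..} y))
      (c powr b / Gamma b * (Gamma b / (s + c) powr b))"
    using assms by (intro has_bochner_integral_mult_right has_bochner_integral_gamma_weight) auto
  moreover have "c powr b / Gamma b * (Gamma b / (s + c) powr b) = (c / (s + c)) powr b"
    using assms Gamma_real_pos[of b, THEN less_imp_neq] by (simp add: powr_divide)
  moreover have "(\<lambda>y. c powr b / Gamma b * (y powr (b - 1) * exp (- (s + c) * y) * indicator {0<..} y)) =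
      (\<lambda>y. gamma_density b c y * exp (- s * y))"
    using assms by (auto simp: gamma_density_eq algebra_simps simp flip: exp_add)
  ultimately show ?thesis by simp
qed

lemma nn_integral_gamma_density:
  assumes "0 < b" "0 < c"
  shows "(\<integral>\<^sup>+y. ennreal (gamma_density b c y) \<partial>lborel) = 1"
  using has_bochner_integral_gamma_density_laplace[OF assms, of 0] assms
  by (subst nn_integral_eq_integral) (auto simp: has_bochner_integral_iff gamma_density_nonneg)

lemma real_distribution_gamma_density:
  assumes "0 < b" "0 < c"
  shows "real_distribution (density lborel (gamma_density b c))"
  unfolding real_distribution_def real_distribution_axioms_def
  by (auto intro!: prob_spaceI simp: emeasure_density nn_integral_gamma_density assms)

context prob_space
begin

lemma distributed_gamma_density:
  assumes Z [measurable]: "Z \<in> borel_measurable M" and pos: "AE \<omega> in M. 0 < Z \<omega>" and bc: "0 < b" "0 < c"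
    and laplace: "\<And>s. 0 < s \<Longrightarrow> mixed_moment M Z 0 0 s = (c / (s + c)) powr b"
  shows "distributed M lborel Z (gamma_density b c)"
proof -
  have "distr M borel Z = density lborel (gamma_density b c)"
  proof (rule laplace_uniqueness)
    show "real_distribution (distr M borel Z)" by (rule real_distribution_distr) measurable
    show "real_distribution (density lborel (gamma_density b c))"
      using bc by (rule real_distribution_gamma_density)
    show "AE x in distr M borel Z. 0 \<le> x"
      using pos by (subst AE_distr_iff) (auto elim: eventually_mono)
    show "AE x in density lborel (gamma_density b c). 0 \<le> x"
      using bc by (subst AE_density) (auto simp: gamma_density_eq indicator_def intro!: AE_I2)
    show "(\<integral>x. exp (- real n * x) \<partial>distr M borel Z) = (\<integral>x. exp (- real n * x) \<partial>density lborel (gamma_density b c))" for n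
    proof -
      have "(\<integral>x. exp (- real n * x) \<partial>density lborel (gamma_density b c)) =
          (\<integral>y. gamma_density b c y * exp (- real n * y) \<partial>lborel)"
        using bc by (subst integral_density) (auto simp: gamma_density_nonneg)
      also have "\<dots> = (c / (real n + c)) powr b"
        using has_bochner_integral_gamma_density_laplace[OF bc, of "real n"]
        by (simp add: has_bochner_integral_iff)
      \<comment> \<open>The hypothesis covers only \<open>s > 0\<close>; for \<open>n = 0\<close>
        both sides are 1.\<close>
      also have "\<dots> = (\<integral>\<omega>. exp (- real n * Z \<omega>) \<partial>M)"
        using laplace[of "real n"] bc by (cases "n = 0") (auto simp: mixed_moment_def prob_space)
      finally show ?thesis by (simp add: integral_distr)
    qed
  qed
  then show ?thesis by (simp add: distributed_def cong: distr_cong)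
qed

section \<open>The Kummer law of \<open>X\<close>: one test function integrated in two ways\<close>

text \<open>For fixed \<open>s\<close>, rescale the gamma variable by \<open>1 + s\<close>. The
  Jacobian and the power in the density combine to \<open>(1 + s) powr b\<close>, and the rate
  contributes the coupling \<open>exp (- c * s * t)\<close>, symmetric in \<open>s\<close> and
  \<open>t\<close>. The lemma serves both for \<open>(X, Y)\<close> and for
  \<open>(U, V)\<close>.\<close>

lemma nn_integral_gamma_fibre:
  fixes S T :: "'a \<Rightarrow> real" and h :: "real \<times> real \<Rightarrow> ennreal"
  assumes indep: "indep_var borel S borel T" and pos: "AE \<omega> in M. 0 < S \<omega>"
    and T: "distributed M lborel T (gamma_density b c)" and bc: "0 < b" "0 < c"
    and h [measurable]: "h \<in> borel_measurable (borel \<Otimes>\<^sub>M borel)"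
  shows "(\<integral>\<^sup>+\<omega>. h (S \<omega>, T \<omega> / (1 + S \<omega>)) \<partial>M) =
    (\<integral>\<^sup>+s. ennreal ((1 + s) powr b) *
      (\<integral>\<^sup>+t. h (s, t) * ennreal (gamma_density b c t * exp (- c * s * t)) \<partial>lborel) \<partial>distr M borel S)"
proof -
  have [measurable]: "S \<in> borel_measurable M" "T \<in> borel_measurable M"
    using indep indep_var_rv1 indep_var_rv2 by blast+
  have distrT: "distr M borel T = density lborel (gamma_density b c)"
    using T by (simp add: distributed_def cong: distr_cong)
  have "(\<integral>\<^sup>+\<omega>. h (S \<omega>, T \<omega> / (1 + S \<omega>)) \<partial>M) =
      (\<integral>\<^sup>+p. h (fst p, snd p / (1 + fst p)) \<partial>distr M (borel \<Otimes>\<^sub>M borel) (\<lambda>\<omega>. (S \<omega>, T \<omega>)))"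
    by (subst nn_integral_distr) auto
  also have "distr M (borel \<Otimes>\<^sub>M borel) (\<lambda>\<omega>. (S \<omega>, T \<omega>)) = distr M borel S \<Otimes>\<^sub>M distr M borel T"
    using indep by (simp add: indep_var_distribution_eq)
  also have "(\<integral>\<^sup>+p. h (fst p, snd p / (1 + fst p)) \<partial>(distr M borel S \<Otimes>\<^sub>M distr M borel T)) =
      (\<integral>\<^sup>+s. \<integral>\<^sup>+t. h (s, t / (1 + s)) \<partial>distr M borel T \<partial>distr M borel S)"
  proof -
    interpret T: prob_space "distr M borel T" by (rule prob_space_distr) simp
    show ?thesis by (subst T.nn_integral_fst[symmetric]) auto
  qed
  also have "\<dots> = (\<integral>\<^sup>+s. ennreal ((1 + s) powr b) *
      (\<integral>\<^sup>+t. h (s, t) * ennreal (gamma_density b c t * exp (- c * s * t)) \<partial>lborel) \<partial>distr M borel S)"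
  proof (rule nn_integral_cong_AE)
    have "AE s in distr M borel S. 0 < s" using pos by (subst AE_distr_iff) auto
    then show "AE s in distr M borel S. (\<integral>\<^sup>+t. h (s, t / (1 + s)) \<partial>distr M borel T) = ennreal ((1 + s) powr b) *
      (\<integral>\<^sup>+t. h (s, t) * ennreal (gamma_density b c t * exp (- c * s * t)) \<partial>lborel)"
    proof eventually_elim
      case (elim s)
      have scale: "(1 + s) * gamma_density b c ((1 + s) * t) =
          (1 + s) powr b * (gamma_density b c t * exp (- c * s * t))" for t
      proof (cases "0 < t")
        case True
        have "(1 + s) * (1 + s) powr (b - 1) = (1 + s) powr b" using elim by (simp add: powr_mult_base)
        moreover have "exp (- c * ((1 + s) * t)) = exp (- c * t) * exp (- c * s * t)"
          by (simp add: algebra_simps flip: exp_add)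
        ultimately show ?thesis using True elim bc by (simp add: gamma_density_eq powr_mult mult_ac)
      next
        case False
        then show ?thesis using elim bc by (simp add: gamma_density_eq zero_less_mult_iff)
      qed
      have "(\<integral>\<^sup>+t. h (s, t / (1 + s)) \<partial>distr M borel T) =
          (\<integral>\<^sup>+t. ennreal (gamma_density b c t) * h (s, t / (1 + s)) \<partial>lborel)"
        unfolding distrT by (subst nn_integral_density) auto
      also have "\<dots> = ennreal (1 + s) * (\<integral>\<^sup>+t. ennreal (gamma_density b c (0 + (1 + s) * t)) * h (s, (0 + (1 + s) * t) / (1 + s)) \<partial>lborel)"
        using elim by (subst nn_integral_real_affine[where c = "1 + s" and t = 0]) auto
      also have "\<dots> = (\<integral>\<^sup>+t. ennreal ((1 + s) * gamma_density b c ((1 + s) * t)) * h (s, t) \<partial>lborel)"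
        using elim by (subst nn_integral_cmult[symmetric]) (auto simp: ennreal_mult' mult.assoc)
      also have "\<dots> = (\<integral>\<^sup>+t. ennreal ((1 + s) powr b) * (h (s, t) * ennreal (gamma_density b c t * exp (- c * s * t))) \<partial>lborel)"
        unfolding scale
        by (subst ennreal_mult') (simp_all only: mult_ac powr_ge_zero)
      finally show ?case by (simp add: nn_integral_cmult)
    qed
  qed
  finally show ?thesis .
qed

end

lemma normalized_scale:
  assumes "k \<noteq> 0"
  shows "normalized (\<lambda>x. k * f x) = normalized f"
  using assms by (simp add: normalized_def fun_eq_iff)

text \<open>With second parameter \<open>b - a\<close> the exponent of \<open>1 + x\<close> is just
  \<open>b\<close>, so the Kummer weight is a gamma weight over \<open>(1 + x) powr b\<close>; the
  gamma constant cancels on normalising.\<close>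

lemma kummer_density_conv_gamma_density:
  assumes "0 < a" "0 < c"
  shows "kummer_density a (b - a) c = normalized (\<lambda>x. gamma_density a c x / (1 + x) powr b)"
proof -
  have eq: "(\<lambda>x. gamma_density a c x / (1 + x) powr b) = (\<lambda>x. c powr a / Gamma a *
      (x powr (a - 1) * exp (- c * x) / (1 + x) powr b * indicator {0<..} x))"
    using assms by (simp add: gamma_density_eq)
  have "c powr a / Gamma a \<noteq> 0"
    using assms Gamma_real_pos[of a, THEN less_imp_neq] by simp
  then have "normalized (\<lambda>x. gamma_density a c x / (1 + x) powr b) =
      normalized (\<lambda>x. x powr (a - 1) * exp (- c * x) / (1 + x) powr b * indicator {0<..} x)"
    unfolding eq by (rule normalized_scale)
  then show ?thesis by (simp add: kummer_density_def)
qed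

lemma borel_measurable_kummer_density [measurable]: "kummer_density a b c \<in> borel_measurable borel"
  unfolding kummer_density_def normalized_def[abs_def] by measurable

context prob_space
begin

text \<open>Through \<open>(X, Y)\<close> the integral of \<open>h (X, U)\<close> collapses to the
  probability of \<open>X\<close> lying in \<open>A\<close>; through \<open>(U, V)\<close> it
  factors into a constant times the integral of \<open>w\<close> over \<open>A\<close>. Total mass 1
  then fixes the constant.\<close>

lemma distributed_kummer_density:
  assumes XY: "indep_var borel X borel Y" and UV: "indep_var borel U borel V"
    and posX: "AE \<omega> in M. 0 < X \<omega>" and posU: "AE \<omega> in M. 0 < U \<omega>"
    and U: "AE \<omega> in M. U \<omega> = Y \<omega> / (1 + X \<omega>)" and X: "AE \<omega> in M. X \<omega> = V \<omega> / (1 + U \<omega>)"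
    and Y: "distributed M lborel Y (gamma_density b c)" and V: "distributed M lborel V (gamma_density a c)"
    and abc: "0 < a" "0 < b" "0 < c"
  shows "distributed M lborel X (kummer_density a (b - a) c)"
proof -
  have [measurable]: "X \<in> borel_measurable M" "Y \<in> borel_measurable M"
      "U \<in> borel_measurable M" "V \<in> borel_measurable M"
    using XY UV indep_var_rv1 indep_var_rv2 by blast+
  define w where "w x = gamma_density a c x / (1 + x) powr b" for x
  have [measurable]: "w \<in> borel_measurable borel" unfolding w_def[abs_def] by measurable
  have w_nonneg: "0 \<le> w x" for x using abc by (simp add: w_def gamma_density_nonneg)
  \<comment> \<open>An extended nonnegative number, possibly infinite at this stage; finiteness
    follows from \<open>KW\<close>.\<close>
  define K where "K = (\<integral>\<^sup>+u. ennreal ((1 + u) powr a) \<partial>distr M borel U)"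
  have law: "emeasure (distr M borel X) A = K * (\<integral>\<^sup>+x. ennreal (w x) * indicator A x \<partial>lborel)"
    if [measurable]: "A \<in> sets borel" for A
  proof -
    \<comment> \<open>The weight cancels the coupling factor \<open>exp (- c * x * u)\<close> and the power of \<open>1 + x\<close> that
      arise when the gamma variable is rescaled by \<open>1 + x\<close> or \<open>1 + u\<close>.\<close>
    define h where "h = (\<lambda>(x, u). indicator A x * ennreal (exp (c * x * u) / (1 + x) powr b))"
    have [measurable]: "h \<in> borel_measurable (borel \<Otimes>\<^sub>M borel)" unfolding h_def by measurable
    have "(\<integral>\<^sup>+\<omega>. h (X \<omega>, U \<omega>) \<partial>M) = (\<integral>\<^sup>+\<omega>. h (X \<omega>, Y \<omega> / (1 + X \<omega>)) \<partial>M)"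
      using U by (intro nn_integral_cong_AE) (auto elim: eventually_mono)
    also have "\<dots> = (\<integral>\<^sup>+x. ennreal ((1 + x) powr b) *
        (\<integral>\<^sup>+u. h (x, u) * ennreal (gamma_density b c u * exp (- c * x * u)) \<partial>lborel) \<partial>distr M borel X)"
      using abc by (intro nn_integral_gamma_fibre XY posX Y) auto
    also have "\<dots> = (\<integral>\<^sup>+x. indicator A x \<partial>distr M borel X)"
    proof (rule nn_integral_cong_AE)
      have "AE x in distr M borel X. 0 < x" using posX by (subst AE_distr_iff) auto
      then show "AE x in distr M borel X. ennreal ((1 + x) powr b) *
        (\<integral>\<^sup>+u. h (x, u) * ennreal (gamma_density b c u * exp (- c * x * u)) \<partial>lborel) = indicator A x"
      proof eventually_elim
        case (elim x)
        \<comment> \<open>After the cancellation only the gamma density depends on \<open>u\<close>,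
          and its integral is 1.\<close>
        have "h (x, u) * ennreal (gamma_density b c u * exp (- c * x * u)) =
            (indicator A x * ennreal (1 / (1 + x) powr b)) * ennreal (gamma_density b c u)" for u
        proof -
          have "ennreal (exp (c * x * u) / (1 + x) powr b) * ennreal (gamma_density b c u * exp (- c * x * u)) =
              ennreal (exp (c * x * u) / (1 + x) powr b * (gamma_density b c u * exp (- c * x * u)))"
            by (rule ennreal_mult'[symmetric]) simp
          also have "exp (c * x * u) / (1 + x) powr b * (gamma_density b c u * exp (- c * x * u)) =
              1 / (1 + x) powr b * gamma_density b c u"
            by (simp add: exp_minus field_simps)
          also have "ennreal \<dots> = ennreal (1 / (1 + x) powr b) * ennreal (gamma_density b c u)"
            by (rule ennreal_mult') simp
          finally show ?thesis by (simp only: h_def prod.case mult.assoc)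
        qed
        then have "ennreal ((1 + x) powr b) *
            (\<integral>\<^sup>+u. h (x, u) * ennreal (gamma_density b c u * exp (- c * x * u)) \<partial>lborel) =
            ennreal ((1 + x) powr b) * (indicator A x * ennreal (1 / (1 + x) powr b))"
          using abc by (simp add: nn_integral_cmult nn_integral_gamma_density)
        also have "\<dots> = indicator A x * ennreal ((1 + x) powr b * (1 / (1 + x) powr b))"
          by (subst ennreal_mult') (simp_all only: mult_ac powr_ge_zero)
        finally show ?case using elim by simp
      qed
    qed
    also have "\<dots> = emeasure (distr M borel X) A" by simp
    finally have 1: "(\<integral>\<^sup>+\<omega>. h (X \<omega>, U \<omega>) \<partial>M) = emeasure (distr M borel X) A" .
    \<comment> \<open>The fibre lemma lists the conditioning variable first, and on this side that
      is \<open>U\<close>.\<close>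
    define h' where "h' = (\<lambda>p. h (snd p, fst p))"
    have [measurable]: "h' \<in> borel_measurable (borel \<Otimes>\<^sub>M borel)" unfolding h'_def by measurable
    have "(\<integral>\<^sup>+\<omega>. h (X \<omega>, U \<omega>) \<partial>M) = (\<integral>\<^sup>+\<omega>. h' (U \<omega>, V \<omega> / (1 + U \<omega>)) \<partial>M)"
      using X by (intro nn_integral_cong_AE) (auto simp: h'_def elim: eventually_mono)
    also have "\<dots> = (\<integral>\<^sup>+u. ennreal ((1 + u) powr a) *
        (\<integral>\<^sup>+x. h' (u, x) * ennreal (gamma_density a c x * exp (- c * u * x)) \<partial>lborel) \<partial>distr M borel U)"
      using abc by (intro nn_integral_gamma_fibre UV posU V) auto
    also have "\<dots> = (\<integral>\<^sup>+u. ennreal ((1 + u) powr a) *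
        (\<integral>\<^sup>+x. ennreal (w x) * indicator A x \<partial>lborel) \<partial>distr M borel U)"
    proof -
      \<comment> \<open>The right-hand side is free of \<open>u\<close>, so the double integral
        becomes a product.\<close>
      have "h' (u, x) * ennreal (gamma_density a c x * exp (- c * u * x)) = ennreal (w x) * indicator A x" for u x
      proof -
        have "ennreal (w x) = ennreal (exp (c * x * u) / (1 + x) powr b * (gamma_density a c x * exp (- c * u * x)))"
          by (simp add: w_def exp_minus field_simps)
        also have "\<dots> = ennreal (exp (c * x * u) / (1 + x) powr b) * ennreal (gamma_density a c x * exp (- c * u * x))"
          by (rule ennreal_mult') simp
        finally show ?thesis by (simp only: h'_def h_def prod.case fst_conv snd_conv) (simp only: mult_ac)
      qed
      then show ?thesis by simp
    qed
    also have "\<dots> = K * (\<integral>\<^sup>+x. ennreal (w x) * indicator A x \<partial>lborel)"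
      unfolding K_def by (rule nn_integral_multc) measurable
    finally show ?thesis using 1 by simp
  qed
  have w_int: "integrable lborel w"
  proof (rule Bochner_Integration.integrable_bound)
    show "integrable lborel (gamma_density a c)"
      using has_bochner_integral_gamma_density_laplace[of a c 0] abc by (simp add: has_bochner_integral_iff)
    have "w x \<le> gamma_density a c x" for x
    proof (cases "0 < x")
      case True
      then have "1 \<le> (1 + x) powr b" using abc by (simp add: ge_one_powr_ge_zero)
      then show ?thesis using divide_left_mono[of 1 "(1 + x) powr b" "gamma_density a c x"] abc True
        by (simp add: w_def gamma_density_nonneg)
    qed (use abc in \<open>simp add: w_def gamma_density_eq\<close>)
    then show "AE x in lborel. norm (w x) \<le> norm (gamma_density a c x)"
      using w_nonneg abc by (simp add: gamma_density_nonneg)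
  qed simp
  define W where "W = (\<integral>x. w x \<partial>lborel)"
  have W: "(\<integral>\<^sup>+x. ennreal (w x) \<partial>lborel) = ennreal W"
    unfolding W_def using w_int w_nonneg by (intro nn_integral_eq_integral) auto
  have "emeasure (distr M borel X) UNIV = 1"
    using prob_space.emeasure_space_1[OF prob_space_distr[of X borel]] by simp
  \<comment> \<open>The case of the whole line; it rules out both \<open>W = 0\<close> and infinite
    \<open>K\<close>.\<close>
  then have KW: "K * ennreal W = 1" using law[of UNIV] W by simp
  then have "0 < W" by (metis ennreal_neg mult_zero_right not_le zero_neq_one)
  have K: "K = ennreal (1 / W)"
  proof -
    have "K = K * (ennreal W * ennreal (1 / W))"
      using \<open>0 < W\<close> by (simp add: ennreal_mult'[symmetric])
    also have "\<dots> = ennreal (1 / W)" using KW by (simp add: mult.assoc[symmetric])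
    finally show ?thesis .
  qed
  have "distr M borel X = density lborel (kummer_density a (b - a) c)"
  proof (rule measure_eqI)
    fix A assume "A \<in> sets (distr M borel X)"
    then have [measurable]: "A \<in> sets borel" by simp
    have "emeasure (density lborel (kummer_density a (b - a) c)) A =
        (\<integral>\<^sup>+x. ennreal (1 / W * w x) * indicator A x \<partial>lborel)"
      using abc by (subst emeasure_density)
        (auto simp: kummer_density_conv_gamma_density normalized_def W_def w_def[abs_def] mult.commute)
    also have "\<dots> = (\<integral>\<^sup>+x. ennreal (1 / W) * (ennreal (w x) * indicator A x) \<partial>lborel)"
      using \<open>0 < W\<close> by (subst ennreal_mult') (auto simp: mult.assoc)
    also have "\<dots> = K * (\<integral>\<^sup>+x. ennreal (w x) * indicator A x \<partial>lborel)"
      unfolding K by (rule nn_integral_cmult) measurable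
    finally show "emeasure (distr M borel X) A = emeasure (density lborel (kummer_density a (b - a) c)) A"
      using law[of A] by simp
  qed simp
  then show ?thesis by (simp add: distributed_def cong: distr_cong)
qed

section \<open>The exchange identity and the conclusion\<close>

text \<open>Moving the denominator from \<open>S\<close> to \<open>T\<close> gives a form in which
  the pairs \<open>(X, Y)\<close> and \<open>(U, V)\<close> can be compared, because
  \<open>T / (1 + S)\<close> is \<open>U\<close> for the first pair and \<open>X\<close> for the
  second.\<close>

lemma mixed_moment_product:
  assumes indep: "indep_var borel S borel T"
    and pos: "AE \<omega> in M. 0 < S \<omega>" "AE \<omega> in M. 0 < T \<omega>" and s: "0 < s"
  shows "mixed_moment M S i j s * mixed_moment M T j 0 s =
    (\<integral>\<omega>. S \<omega> ^ i * (T \<omega> / (1 + S \<omega>)) ^ j * exp (- s * (S \<omega> + T \<omega>)) \<partial>M)"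
proof -
  have meas: "S \<in> borel_measurable M" "T \<in> borel_measurable M"
    using indep indep_var_rv1 indep_var_rv2 by blast+
  have "indep_var borel ((\<lambda>x. x ^ i / (1 + x) ^ j * exp (- s * x)) \<circ> S)
      borel ((\<lambda>x. x ^ j / (1 + x) ^ 0 * exp (- s * x)) \<circ> T)"
    using indep by (rule indep_var_compose) auto
  then have "mixed_moment M S i j s * mixed_moment M T j 0 s =
      (\<integral>\<omega>. (S \<omega> ^ i / (1 + S \<omega>) ^ j * exp (- s * S \<omega>)) * (T \<omega> ^ j / (1 + T \<omega>) ^ 0 * exp (- s * T \<omega>)) \<partial>M)"
    unfolding mixed_moment_def o_def
    by (intro indep_var_lebesgue_integral[symmetric] integrable_mixed_moment meas pos s)
  also have "\<dots> = (\<integral>\<omega>. S \<omega> ^ i * (T \<omega> / (1 + S \<omega>)) ^ j * exp (- s * (S \<omega> + T \<omega>)) \<partial>M)"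
  proof (intro Bochner_Integration.integral_cong refl)
    fix \<omega>
    have "exp (- s * (S \<omega> + T \<omega>)) = exp (- s * S \<omega>) * exp (- s * T \<omega>)"
      by (simp add: algebra_simps flip: exp_add)
    then show "(S \<omega> ^ i / (1 + S \<omega>) ^ j * exp (- s * S \<omega>)) * (T \<omega> ^ j / (1 + T \<omega>) ^ 0 * exp (- s * T \<omega>)) =
        S \<omega> ^ i * (T \<omega> / (1 + S \<omega>)) ^ j * exp (- s * (S \<omega> + T \<omega>))"
      by (simp only: power_divide) simp
  qed
  finally show ?thesis .
qed

end

theorem theorem2p5:
  fixes M :: "'a measure" and X Y U V :: "'a \<Rightarrow> real"
  assumes "prob_space M"
    and "X \<in> borel_measurable M" and "Y \<in> borel_measurable M"
    and "AE \<omega> in M. X \<omega> > 0" and "AE \<omega> in M. Y \<omega> > 0"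
    and "nondegenerate M X" and "nondegenerate M Y"
    and "prob_space.indep_var M borel X borel Y"
    and "U = (\<lambda>\<omega>. Y \<omega> / (1 + X \<omega>))"
    and "V = (\<lambda>\<omega>. X \<omega> * (1 + U \<omega>))"
    and "prob_space.indep_var M borel U borel V"
  shows "\<exists>a b c. a > 0 \<and> b > 0 \<and> c > 0 \<and>
           distributed M lborel X (kummer_density a (b - a) c) \<and>
           distributed M lborel Y (gamma_density b c)"
proof -
  interpret prob_space M by fact
  note X = assms(2) and Y = assms(3) and posX = assms(4) and posY = assms(5)
    and XY = assms(8) and UV = assms(11)
  have U: "U \<in> borel_measurable M" and V: "V \<in> borel_measurable M"
    using UV indep_var_rv1 indep_var_rv2 by blast+
  \<comment> \<open>With \<open>Y = U * (1 + X)\<close> and \<open>V = X * (1 + U)\<close>, both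
    sums equal \<open>X + U + X * U\<close>.\<close>
  have pointwise: "AE \<omega> in M. 0 < U \<omega> \<and> 0 < V \<omega> \<and> X \<omega> = V \<omega> / (1 + U \<omega>) \<and> U \<omega> + V \<omega> = X \<omega> + Y \<omega>"
    using posX posY
  proof eventually_elim
    case (elim \<omega>)
    then have "0 < U \<omega>" and UX: "U \<omega> * (1 + X \<omega>) = Y \<omega>" by (simp_all add: assms(9))
    moreover have "V \<omega> = X \<omega> * (1 + U \<omega>)" by (simp add: assms(10))
    moreover have "U \<omega> + X \<omega> * (1 + U \<omega>) = X \<omega> + U \<omega> * (1 + X \<omega>)" by (simp add: algebra_simps)
    ultimately show ?case using elim by simp
  qed
  then have posU: "AE \<omega> in M. 0 < U \<omega>" and posV: "AE \<omega> in M. 0 < V \<omega>"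
    and XV: "AE \<omega> in M. X \<omega> = V \<omega> / (1 + U \<omega>)"
    by (auto elim: eventually_mono)
  \<comment> \<open>Both products are the expectation of
    \<open>X^i * U^j * exp (- s * (X + Y))\<close>; the indices trade places on the
    \<open>(U, V)\<close> side.\<close>
  have exchange: "mixed_moment M X i j s * mixed_moment M Y j 0 s = mixed_moment M U j i s * mixed_moment M V i 0 s"
    if s: "0 < s" for i j s
  proof -
    have "(\<integral>\<omega>. X \<omega> ^ i * (Y \<omega> / (1 + X \<omega>)) ^ j * exp (- s * (X \<omega> + Y \<omega>)) \<partial>M) =
        (\<integral>\<omega>. U \<omega> ^ j * (V \<omega> / (1 + U \<omega>)) ^ i * exp (- s * (U \<omega> + V \<omega>)) \<partial>M)"
    proof (rule integral_cong_AE)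
      show "AE \<omega> in M. X \<omega> ^ i * (Y \<omega> / (1 + X \<omega>)) ^ j * exp (- s * (X \<omega> + Y \<omega>)) =
          U \<omega> ^ j * (V \<omega> / (1 + U \<omega>)) ^ i * exp (- s * (U \<omega> + V \<omega>))"
        using pointwise
      proof eventually_elim
        case (elim \<omega>)
        moreover have "Y \<omega> / (1 + X \<omega>) = U \<omega>" by (simp add: assms(9))
        ultimately show ?case by (metis mult.commute)
      qed
    qed (use X Y U V in measurable)
    then show ?thesis
      by (simp only: mixed_moment_product[OF XY posX posY s] mixed_moment_product[OF UV posU posV s])
  qed
  define r where "r Z n s = mixed_moment M Z (Suc n) 0 s / mixed_moment M Z n 0 s" for Z n s
  have incr: "r Y (Suc j) s - r Y j s = r V (Suc i) s - r V i s" if s: "0 < s" for i j s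
    unfolding r_def
    by (rule equal_increments[where A = "\<lambda>i j. mixed_moment M X i j s" and C = "\<lambda>j i. mixed_moment M U j i s"])
       (intro mixed_moment_pos mixed_moment_split exchange X Y U V posX posY posU posV s)+
  have incr_pos: "r Y 0 s < r Y 1 s" if "0 < s" for s
    using moment_ratio_increment_pos[OF Y posY that assms(7)] by (simp add: r_def numeral_2_eq_2)
  obtain b c where bc: "0 < b" "0 < c" and Yc: "\<And>s. 0 < s \<Longrightarrow> r Y 1 s - r Y 0 s = 1 / (s + c)"
    and Y_laplace: "\<And>s. 0 < s \<Longrightarrow> mixed_moment M Y 0 0 s = (c / (s + c)) powr b"
  proof (rule laplace_transform_of_arithmetic_ratios[OF Y posY, folded r_def])
    show "r Y 0 s < r Y 1 s" if "0 < s" for s using incr_pos[OF that] .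
    show "r Y 2 s - r Y 1 s = r Y 1 s - r Y 0 s" if "0 < s" for s
      \<comment> \<open>Both increments of \<open>Y\<close> equal the same increment of
        \<open>V\<close>, the one with \<open>i = 0\<close>.\<close>
      using incr[OF that, of 1 0] incr[OF that, of 0 0] by (simp add: numeral_2_eq_2)
  qed (rule that)
  obtain a c' where ac': "0 < a" "0 < c'" and Vc: "\<And>s. 0 < s \<Longrightarrow> r V 1 s - r V 0 s = 1 / (s + c')"
    and V_laplace: "\<And>s. 0 < s \<Longrightarrow> mixed_moment M V 0 0 s = (c' / (s + c')) powr a"
  proof (rule laplace_transform_of_arithmetic_ratios[OF V posV, folded r_def])
    show "r V 0 s < r V 1 s" if "0 < s" for s
      \<comment> \<open>Strict positivity passes from \<open>Y\<close> to \<open>V\<close> through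
        the common increment.\<close>
      using incr_pos[OF that] incr[OF that, of 0 0] by simp
    show "r V 2 s - r V 1 s = r V 1 s - r V 0 s" if "0 < s" for s
      using incr[OF that, of 0 1] incr[OF that, of 0 0] by (simp add: numeral_2_eq_2)
  qed (rule that)
  \<comment> \<open>Comparing the common increment at \<open>s = 1\<close> shows that the two rates
    coincide.\<close>
  have "1 / (1 + c) = 1 / (1 + c')" using incr[of 1 0 0] Yc[of 1] Vc[of 1] by simp
  then have "c' = c" using bc ac' by simp
  have Yg: "distributed M lborel Y (gamma_density b c)"
    by (rule distributed_gamma_density[OF Y posY bc Y_laplace])
  have Vg: "distributed M lborel V (gamma_density a c)"
    using V_laplace unfolding \<open>c' = c\<close> by (intro distributed_gamma_density V posV ac' bc)
  have "distributed M lborel X (kummer_density a (b - a) c)"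
    by (rule distributed_kummer_density[OF XY UV posX posU _ XV Yg Vg]) (use ac' bc in \<open>simp_all add: assms(9)\<close>)
  with Yg ac' bc show ?thesis by blast
qed

end
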